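(* Let $\mathcal P=(\mathcal V,\mathcal L,\#,\{\mathcal L_v\}_{v\in\mathcal V},\theta)$ be an instance of the incomplete linear assignment problem (ILAP) and let $\mathcal P'=(\mathcal V',\mathcal L',\{\mathcal L'_v\}_{v\in\mathcal V'},\theta')$ be the LAP instance constructed from $\mathcal P$ as in the context. Then the optimal values of the ILAP $\mathcal P$ and the LAP $\mathcal P'$ are equal.
   Context: **ILAP.** $\mathcal V$ (vertices) and $\mathcal L$ (labels) are finite disjoint sets with a distinguished dummy label $\#\in\mathcal L$. For each $v\in\mathcal V$, $\mathcal L_v\subseteq\mathcal L$ with $\#\in\mathcal L_v$ is the set of allowed labels and $\theta_v\colon\mathcal L_v\to\mathbb R$ a cost function. The ILAP minimizes $\sum_{v\in\mathcal V}\theta_v(x_v)$ over $x\colon\mathcal V\to\mathcal L$ with $x_v\in\mathcal L_v$ for all $v$ and such that each $\ell\in\mathcal L\setminus\{\#\}$ is assigned to at most one vertex ($\#$ may be assigned to arbitrarily many). Put $\mathcal V_\ell=\{v\in\mathcal V\mid\ell\in\mathcal L_v\}$. **LAP.** For a LAP instance $(\mathcal V',\mathcal L',\{\mathcal L'_v\}_{v\in\mathcal V'},\theta')$ with $|\mathcal V'|=|\mathcal L'|$, one minimizes $\sum_{v\in\mathcal V'}\theta'_v(x'_v)$ over bijections $x'\colon\mathcal V'\to\mathcal L'$ with $x'_v\in\mathcal L'_v$ for all $v\in\mathcal V'$. **Reduction.** The LAP instance $\mathcal P'$ is given by $\mathcal V'=\mathcal L'=\mathcal V\cup\mathcal L\setminus\{\#\}$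 (the vertex set $\mathcal V'$ and label set $\mathcal L'$ are regarded as two separate copies of this set); $\mathcal L'_v=(\mathcal L_v\setminus\{\#\})\cup\{v\}$ for $v\in\mathcal V$ and $\mathcal L'_v=\mathcal V_v\cup\{v\}$ for $v\in\mathcal L\setminus\{\#\}$; and for $v\in\mathcal V'$, $\ell\in\mathcal L'_v$: $\theta'_v(\ell)=\theta_v(\ell)/2$ if $v\in\mathcal V,\ell\in\mathcal L$; $\theta'_v(\ell)=\theta_\ell(v)/2$ if $v\in\mathcal L,\ell\in\mathcal V$; $\theta'_v(\ell)=\theta_v(\#)$ if $v,\ell\in\mathcal V$ (so $\ell=v$); $\theta'_v(\ell)=0$ if $v,\ell\in\mathcal L$ (so $\ell=v$). *)

theory Defs
  imports Complex_Main "HOL-Library.FuncSet" "HOL-Library.Extended_Real"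
begin

record ('v, 'l) assignment_problem =
  vertices :: "'v set"
  labels :: "'l set"
  allowed :: "'v \<Rightarrow> 'l set"
  cost :: "'v \<Rightarrow> 'l \<Rightarrow> real"

record ('v, 'l) incomplete_assignment_problem = "('v, 'l) assignment_problem" +
  dummy :: 'l

definition total_cost :: "('v, 'l, 'm) assignment_problem_scheme \<Rightarrow> ('v \<Rightarrow> 'l) \<Rightarrow> real" where
  "total_cost P x = (\<Sum>v\<in>vertices P. cost P v (x v))"

text \<open>
  The optimal value is taken in the extended reals, so that an infeasible problem has
  value \<open>\<infinity>\<close> instead of an unspecified one. For a finite nonempty feasible set the
  infimum is the minimum, see \<open>optimal_value_eq_Min\<close>.
\<close>

definition optimal_value :: "'x set \<Rightarrow> ('x \<Rightarrow> real) \<Rightarrow> ereal" where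
  "optimal_value F c = (INF x\<in>F. ereal (c x))"

lemma optimal_value_eq_Min:
  assumes "finite F" "F \<noteq> {}"
  shows "optimal_value F c = ereal (Min (c ` F))"
proof (rule antisym)
  have "Min (c ` F) \<in> c ` F"
    using assms by (intro Min_in) auto
  then obtain x where "x \<in> F" "Min (c ` F) = c x"
    by auto
  then show "optimal_value F c \<le> ereal (Min (c ` F))"
    unfolding optimal_value_def by (auto intro: INF_lower)
  show "ereal (Min (c ` F)) \<le> optimal_value F c"
    unfolding optimal_value_def using assms by (auto intro!: INF_greatest)
qed


text \<open>
  Vertices and labels of an ILAP live in one type, since the reduction below takes their
  union. Assignments are extensional functions, i.e. they are determined by their values on
  the vertices.
\<close>

definition ilap_instance :: "('a, 'a) incomplete_assignment_problem \<Rightarrow> bool" where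
  "ilap_instance P \<longleftrightarrow>
     finite (vertices P) \<and> finite (labels P) \<and> vertices P \<inter> labels P = {} \<and>
     dummy P \<in> labels P \<and>
     (\<forall>v\<in>vertices P. allowed P v \<subseteq> labels P \<and> dummy P \<in> allowed P v)"

definition ilap_feasible :: "('v, 'l) incomplete_assignment_problem \<Rightarrow> ('v \<Rightarrow> 'l) set" where
  "ilap_feasible P =
     {x \<in> (\<Pi>\<^sub>E v\<in>vertices P. allowed P v).
        \<forall>l\<in>labels P - {dummy P}. \<exists>\<^sub>\<le>\<^sub>1v. v \<in> vertices P \<and> x v = l}"

definition ilap_value :: "('v, 'l) incomplete_assignment_problem \<Rightarrow> ereal" where
  "ilap_value P = optimal_value (ilap_feasible P) (total_cost P)"


definition lap_instance :: "('v, 'l) assignment_problem \<Rightarrow> bool" where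
  "lap_instance Q \<longleftrightarrow>
     finite (vertices Q) \<and> finite (labels Q) \<and> card (vertices Q) = card (labels Q) \<and>
     (\<forall>v\<in>vertices Q. allowed Q v \<subseteq> labels Q)"

definition lap_feasible :: "('v, 'l) assignment_problem \<Rightarrow> ('v \<Rightarrow> 'l) set" where
  "lap_feasible Q =
     {x \<in> (\<Pi>\<^sub>E v\<in>vertices Q. allowed Q v). bij_betw x (vertices Q) (labels Q)}"

definition lap_value :: "('v, 'l) assignment_problem \<Rightarrow> ereal" where
  "lap_value Q = optimal_value (lap_feasible Q) (total_cost Q)"


definition admissible_vertices ::
    "('v, 'l) incomplete_assignment_problem \<Rightarrow> 'l \<Rightarrow> 'v set" where
  "admissible_vertices P l = {v \<in> vertices P. l \<in> allowed P v}"

text \<open>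
  No tagging is needed to keep the two copies of \<open>vertices P \<union> labels P - {dummy P}\<close> apart:
  the vertex set and the label set of a LAP are separate components, and nothing relates
  them except the bijection.
\<close>

definition reduction ::
    "('a, 'a) incomplete_assignment_problem \<Rightarrow> ('a, 'a) assignment_problem" where
  "reduction P =
     \<lparr>vertices = vertices P \<union> labels P - {dummy P},
      labels = vertices P \<union> labels P - {dummy P},
      allowed = (\<lambda>v. if v \<in> vertices P then (allowed P v - {dummy P}) \<union> {v}
                      else admissible_vertices P v \<union> {v}),
      cost = (\<lambda>v l. if v \<in> vertices P \<and> l \<in> labels P then cost P v l / 2
                    else if v \<in> labels P \<and> l \<in> vertices P then cost P l v / 2
                    else if v \<in> vertices P \<and> l \<in> vertices P then cost P v (dummy P)
                    else 0)\<rparr>"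

lemma ilap_feasible_finite_nonempty:
  assumes "ilap_instance P"
  shows "finite (ilap_feasible P)" "ilap_feasible P \<noteq> {}"
proof -
  have "finite (\<Pi>\<^sub>E v\<in>vertices P. allowed P v)"
    using assms by (intro finite_PiE) (auto simp: ilap_instance_def intro: finite_subset)
  then show "finite (ilap_feasible P)"
    by (rule finite_subset[rotated]) (auto simp: ilap_feasible_def)
  have "(\<lambda>v\<in>vertices P. dummy P) \<in> ilap_feasible P"
    using assms by (auto simp: ilap_feasible_def ilap_instance_def Uniq_def)
  then show "ilap_feasible P \<noteq> {}" by blast
qed

lemma lap_instance_reduction:
  assumes "ilap_instance P"
  shows "lap_instance (reduction P)"
  using assms by (auto simp: lap_instance_def ilap_instance_def reduction_def admissible_vertices_def)

lemma lap_feasible_reduction_finite_nonempty: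
  assumes "ilap_instance P"
  shows "finite (lap_feasible (reduction P))" "lap_feasible (reduction P) \<noteq> {}"
proof -
  let ?Q = "reduction P"
  have "lap_instance ?Q"
    using assms by (rule lap_instance_reduction)
  then have "finite (\<Pi>\<^sub>E v\<in>vertices ?Q. allowed ?Q v)"
    by (intro finite_PiE) (auto simp: lap_instance_def intro: finite_subset)
  then show "finite (lap_feasible ?Q)"
    by (rule finite_subset[rotated]) (auto simp: lap_feasible_def)
  have "(\<lambda>v\<in>vertices ?Q. v) \<in> lap_feasible ?Q"
    by (auto simp: lap_feasible_def reduction_def bij_betw_def inj_on_def)
  then show "lap_feasible ?Q \<noteq> {}" by blast
qed

end

theory Submission
  imports Defs
begin

text \<open>
  A LAP solution is a permutation \<open>\<pi>\<close> of \<open>vertices P \<union> labels P - {dummy P}\<close> whose nontrivial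
  moves alternate between vertices and labels. Reading a fixed vertex as one labelled by the
  dummy, both \<open>\<pi>\<close> and its inverse restrict to ILAP solutions, and the cost of \<open>\<pi>\<close> is the mean of
  their costs, so the cheaper one costs at most as much as \<open>\<pi>\<close>. Conversely, an ILAP
  solution is a partial matching and so defines an involution swapping matched pairs; it is its own
  inverse, so the mean is exactly the cost of the ILAP solution.
\<close>

section \<open>Reading self-maps as ILAP assignments\<close>

definition fixed_to_dummy ::
    "('a, 'a) incomplete_assignment_problem \<Rightarrow> ('a \<Rightarrow> 'a) \<Rightarrow> 'a \<Rightarrow> 'a" where
  "fixed_to_dummy P f = (\<lambda>v\<in>vertices P. if f v = v then dummy P else f v)"

lemma vertices_reduction_eq_Un:
  assumes "ilap_instance P"
  shows "vertices (reduction P) = vertices P \<union> (labels P - {dummy P})"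
  using assms by (auto simp: ilap_instance_def reduction_def)

lemma labels_reduction: "labels (reduction P) = vertices (reduction P)"
  by (simp add: reduction_def)

lemma cost_reduction:
  "cost (reduction P) v l =
     (if v \<in> vertices P \<and> l \<in> labels P then cost P v l / 2
      else if v \<in> labels P \<and> l \<in> vertices P then cost P l v / 2
      else if v \<in> vertices P \<and> l \<in> vertices P then cost P v (dummy P)
      else 0)"
  by (simp add: reduction_def)

text \<open>Every non-dummy value is taken over unchanged from \<open>f\<close>, so injectivity of
  \<open>f\<close> makes its vertex unique. The map \<open>f\<close> is kept arbitrary so that both
  a LAP solution and its inverse can be inserted.\<close>

lemma fixed_to_dummy_feasible:
  assumes P: "ilap_instance P"
    and inj: "inj_on f (vertices P)"
    and allowed: "\<And>v. v \<in> vertices P \<Longrightarrow> f v \<in> insert v (allowed P v - {dummy P})"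
  shows "fixed_to_dummy P f \<in> ilap_feasible P"
proof -
  have "fixed_to_dummy P f \<in> (\<Pi>\<^sub>E v\<in>vertices P. allowed P v)"
  proof (rule PiE_I)
    fix v assume v: "v \<in> vertices P"
    then have "dummy P \<in> allowed P v"
      using P by (simp add: ilap_instance_def)
    with v allowed[OF v] show "fixed_to_dummy P f v \<in> allowed P v"
      by (auto simp: fixed_to_dummy_def)
  qed (simp add: fixed_to_dummy_def)
  moreover have "\<exists>\<^sub>\<le>\<^sub>1v. v \<in> vertices P \<and> fixed_to_dummy P f v = l"
    if "l \<in> labels P - {dummy P}" for l
  proof (rule Uniq_I)
    fix u v
    assume uv: "u \<in> vertices P \<and> fixed_to_dummy P f u = l"
      "v \<in> vertices P \<and> fixed_to_dummy P f v = l"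
    have "f w = l" if "w \<in> vertices P" "fixed_to_dummy P f w = l" for w
      using that \<open>l \<in> labels P - {dummy P}\<close>
      by (simp add: fixed_to_dummy_def split: if_splits)
    with uv show "v = u"
      using inj by (metis inj_onD)
  qed
  ultimately show ?thesis
    by (simp add: ilap_feasible_def)
qed

section \<open>LAP solutions as pairs of ILAP solutions\<close>

context
  fixes P :: "('a, 'a) incomplete_assignment_problem" and \<pi> :: "'a \<Rightarrow> 'a"
  assumes P: "ilap_instance P"
    and \<pi>: "\<pi> \<in> lap_feasible (reduction P)"
begin

private abbreviation "W \<equiv> vertices (reduction P)"
private abbreviation "\<sigma> \<equiv> inv_into W \<pi>"

private lemma bij: "bij_betw \<pi> W W"
  using \<pi> by (simp add: lap_feasible_def labels_reduction)

private lemma \<pi>_inv: "w \<in> W \<Longrightarrow> \<pi> (\<sigma> w) = w"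
  using bij by (simp add: bij_betw_inv_into_right)

private lemma inv_in: "w \<in> W \<Longrightarrow> \<sigma> w \<in> W"
  using bij_betw_inv_into[OF bij] by (auto dest: bij_betwE)

text \<open>Consequently the two ILAP solutions read off from \<open>\<pi>\<close> and
  \<open>\<sigma>\<close> give the dummy to the same vertices.\<close>

private lemma inv_fixed_iff: "w \<in> W \<Longrightarrow> \<sigma> w = w \<longleftrightarrow> \<pi> w = w"
  using bij by (metis \<pi>_inv bij_betw_inv_into_left)

private lemma vertex_in: "v \<in> vertices P \<Longrightarrow> v \<in> W"
  using vertices_reduction_eq_Un[OF P] by simp

private lemma \<pi>_allowed: "w \<in> W \<Longrightarrow> \<pi> w \<in> allowed (reduction P) w"
  using \<pi> by (auto simp: lap_feasible_def)

private lemma \<pi>_vertex: "v \<in> vertices P \<Longrightarrow> \<pi> v \<in> insert v (allowed P v - {dummy P})"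
  using \<pi>_allowed[OF vertex_in] by (simp add: reduction_def)

private lemma \<pi>_label:
  assumes "l \<in> labels P - {dummy P}"
  shows "\<pi> l = l \<or> \<pi> l \<in> vertices P \<and> l \<in> allowed P (\<pi> l)"
proof -
  have "l \<in> W" "l \<notin> vertices P"
    using assms P vertices_reduction_eq_Un[OF P] by (auto simp: ilap_instance_def)
  with \<pi>_allowed[of l] show ?thesis
    by (auto simp: reduction_def admissible_vertices_def)
qed

text \<open>A vertex that \<open>\<pi>\<close> sends to \<open>v\<close> must be \<open>v\<close>
  itself, since all other moves from vertices end in labels. A label sent to \<open>v\<close> is
  allowed at \<open>v\<close>, because the reduction permits a label to move only to its admissible
  vertices.\<close>

private lemma inv_vertex:
  assumes v: "v \<in> vertices P"
  shows "\<sigma> v \<in> insert v (allowed P v - {dummy P})"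
proof (cases "\<sigma> v \<in> vertices P")
  case True
  with \<pi>_vertex[of "\<sigma> v"] \<pi>_inv[OF vertex_in[OF v]] v P show ?thesis
    by (auto simp: ilap_instance_def)
next
  case False
  with inv_in[OF vertex_in[OF v]] have "\<sigma> v \<in> labels P - {dummy P}"
    using vertices_reduction_eq_Un[OF P] by auto
  with \<pi>_label[of "\<sigma> v"] \<pi>_inv[OF vertex_in[OF v]] show ?thesis
    by auto
qed

lemma fixed_to_dummy_lap_feasible: "fixed_to_dummy P \<pi> \<in> ilap_feasible P"
proof (rule fixed_to_dummy_feasible[OF P])
  show "inj_on \<pi> (vertices P)"
    using bij vertex_in by (meson bij_betw_imp_inj_on inj_on_subset subsetI)
qed (rule \<pi>_vertex)

lemma fixed_to_dummy_inv_lap_feasible: "fixed_to_dummy P \<sigma> \<in> ilap_feasible P"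
proof (rule fixed_to_dummy_feasible[OF P])
  show "inj_on \<sigma> (vertices P)"
    using bij_betw_inv_into[OF bij] vertex_in
    by (meson bij_betw_imp_inj_on inj_on_subset subsetI)
qed (rule inv_vertex)

text \<open>Moves out of vertices pay half the cost of the solution from \<open>\<pi>\<close>. The
  cost of a move out of a label is charged to the vertex it reaches, which turns these moves into
  half the cost of the solution from \<open>\<sigma>\<close>.\<close>

lemma total_cost_reduction:
  "total_cost (reduction P) \<pi> =
     (total_cost P (fixed_to_dummy P \<pi>) + total_cost P (fixed_to_dummy P \<sigma>)) / 2"
proof -
  let ?V = "vertices P" and ?L = "labels P - {dummy P}" and ?c = "cost (reduction P)"
  have W: "W = ?V \<union> ?L" and fin: "finite ?V" "finite ?L" and disj: "?V \<inter> labels P = {}"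
    using P vertices_reduction_eq_Un[OF P] by (auto simp: ilap_instance_def)
  have split_sum: "sum f W = sum f ?V + sum f ?L" for f :: "'a \<Rightarrow> real"
    unfolding W using fin disj by (intro sum.union_disjoint) auto
  \<comment> \<open>\<open>\<sigma>\<close> permutes \<open>W\<close> but need not preserve the set
    of labels, so the label costs are extended by zero to \<open>W\<close> before
    reindexing.\<close>
  define g where "g w = (if w \<in> ?L then ?c w (\<pi> w) else 0)" for w
  have g_vertex: "g (\<sigma> v) = (if \<sigma> v = v then 0 else cost P v (\<sigma> v) / 2)" if v: "v \<in> ?V" for v
  proof -
    have "\<sigma> v = v \<or> \<sigma> v \<in> ?L"
      using inv_vertex[OF v] v P by (auto simp: ilap_instance_def)
    then show ?thesis
      using v disj \<pi>_inv[OF vertex_in[OF v]] by (auto simp: g_def cost_reduction)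
  qed
  \<comment> \<open>The preimage of \<open>l\<close> is a vertex, where \<open>g\<close> vanishes,
    or a label, and label-to-label pairs cost 0.\<close>
  have g_label: "g (\<sigma> l) = 0" if l: "l \<in> ?L" for l
  proof (cases "\<sigma> l \<in> ?L")
    case True
    moreover have "\<pi> (\<sigma> l) = l"
      using l W by (intro \<pi>_inv) auto
    ultimately show ?thesis
      using l disj by (auto simp: g_def cost_reduction)
  qed (auto simp: g_def)
  have "(\<Sum>l\<in>?L. ?c l (\<pi> l)) = sum g ?L"
    by (intro sum.cong) (auto simp: g_def)
  also have "\<dots> = sum g W"
    using disj by (auto simp: split_sum g_def intro!: sum.neutral)
  also have "\<dots> = (\<Sum>w\<in>W. g (\<sigma> w))"
    by (rule sum.reindex_bij_betw[OF bij_betw_inv_into[OF bij], symmetric])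
  also have "\<dots> = (\<Sum>v\<in>?V. if \<sigma> v = v then 0 else cost P v (\<sigma> v) / 2)"
    by (simp add: split_sum g_vertex g_label)
  finally have "total_cost (reduction P) \<pi> =
      (\<Sum>v\<in>?V. ?c v (\<pi> v) + (if \<sigma> v = v then 0 else cost P v (\<sigma> v) / 2))"
    by (simp add: total_cost_def split_sum sum.distrib)
  \<comment> \<open>At a fixed vertex the first summand carries the whole dummy cost, that is, both
    halves, and the second is 0. At any other vertex each summand supplies its own half.\<close>
  also have "\<dots> =
      (\<Sum>v\<in>?V. (cost P v (fixed_to_dummy P \<pi> v) + cost P v (fixed_to_dummy P \<sigma> v)) / 2)"
  proof (rule sum.cong)
    fix v assume v: "v \<in> ?V"
    then have "\<pi> v = v \<or> \<pi> v \<in> labels P"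
      using \<pi>_vertex[OF v] P by (auto simp: ilap_instance_def)
    then show "?c v (\<pi> v) + (if \<sigma> v = v then 0 else cost P v (\<sigma> v) / 2) =
        (cost P v (fixed_to_dummy P \<pi> v) + cost P v (fixed_to_dummy P \<sigma> v)) / 2"
      using v disj inv_fixed_iff[OF vertex_in[OF v]]
      by (auto simp: fixed_to_dummy_def cost_reduction add_divide_distrib)
  qed simp
  finally show ?thesis
    by (simp add: total_cost_def sum.distrib sum_divide_distrib[symmetric])
qed

end

section \<open>Involutions from ILAP solutions\<close>

definition matching_involution ::
    "('a, 'a) incomplete_assignment_problem \<Rightarrow> ('a \<Rightarrow> 'a) \<Rightarrow> 'a \<Rightarrow> 'a" where
  "matching_involution P x = (\<lambda>w\<in>vertices (reduction P).
     if w \<in> vertices P then if x w = dummy P then w else x w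
     else if \<exists>v\<in>vertices P. x v = w then THE v. v \<in> vertices P \<and> x v = w
     else w)"

context
  fixes P :: "('a, 'a) incomplete_assignment_problem" and x :: "'a \<Rightarrow> 'a"
  assumes P: "ilap_instance P"
    and x: "x \<in> ilap_feasible P"
begin

private abbreviation "\<tau> \<equiv> matching_involution P x"

private lemma x_allowed: "v \<in> vertices P \<Longrightarrow> x v \<in> allowed P v"
  using x by (auto simp: ilap_feasible_def)

private lemma x_label: "v \<in> vertices P \<Longrightarrow> x v \<in> labels P \<and> x v \<notin> vertices P"
  using x_allowed P by (fastforce simp: ilap_instance_def)

private lemma \<tau>_vertex: "v \<in> vertices P \<Longrightarrow> \<tau> v = (if x v = dummy P then v else x v)"
  using vertices_reduction_eq_Un[OF P] by (simp add: matching_involution_def)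

text \<open>Feasibility gives a non-dummy label to at most one vertex, so the \<open>THE\<close> in
  the definition denotes its partner. The dummy may be shared and has to be excluded.\<close>

private lemma \<tau>_matched:
  assumes "v \<in> vertices P" "x v \<noteq> dummy P"
  shows "\<tau> (x v) = v"
proof -
  have "\<exists>\<^sub>\<le>\<^sub>1u. u \<in> vertices P \<and> x u = x v"
    using x x_label assms by (auto simp: ilap_feasible_def)
  then have "(THE u. u \<in> vertices P \<and> x u = x v) = v"
    using assms by (intro the1_equality') auto
  then show ?thesis
    using assms x_label[of v] vertices_reduction_eq_Un[OF P]
    by (auto simp: matching_involution_def)
qed

text \<open>The label case exposes the partner, so that the involution property and membership in
  the allowed sets follow without returning to \<open>THE\<close>.\<close>

private lemma matching_involution_cases:
  assumes "w \<in> vertices (reduction P)"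
  obtains (vertex) "w \<in> vertices P" "x w \<noteq> dummy P" "\<tau> w = x w"
  | (label) v where "v \<in> vertices P" "x v \<noteq> dummy P" "w = x v" "\<tau> w = v"
  | (fixed) "\<tau> w = w"
proof (cases "w \<in> vertices P")
  case True
  with \<tau>_vertex vertex fixed show thesis
    by (cases "x w = dummy P") auto
next
  case False
  show thesis
  proof (cases "\<exists>v\<in>vertices P. x v = w")
    case True
    then obtain v where "v \<in> vertices P" "w = x v" by auto
    \<comment> \<open>The dummy lies outside the LAP vertex set, so a label there that is a value of
      \<open>x\<close> is a genuine match.\<close>
    moreover from this have "x v \<noteq> dummy P"
      using assms False vertices_reduction_eq_Un[OF P] by auto
    ultimately show thesis
      using label \<tau>_matched by auto
  next
    case no: False
    with assms \<open>w \<notin> vertices P\<close> fixed show thesis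
      by (auto simp: matching_involution_def)
  qed
qed

private lemma \<tau>_\<tau>: "w \<in> vertices (reduction P) \<Longrightarrow> \<tau> (\<tau> w) = w"
  by (erule matching_involution_cases) (auto simp: \<tau>_vertex \<tau>_matched)

private lemma \<tau>_in:
  assumes "w \<in> vertices (reduction P)"
  shows "\<tau> w \<in> vertices (reduction P)" "\<tau> w \<in> allowed (reduction P) w"
proof -
  have "\<tau> w \<in> vertices (reduction P) \<and> \<tau> w \<in> allowed (reduction P) w"
    using assms
  proof (cases rule: matching_involution_cases)
    case vertex
    then show ?thesis
      using x_label x_allowed vertices_reduction_eq_Un[OF P] by (auto simp: reduction_def)
  next
    case (label v)
    then show ?thesis
      using x_label x_allowed vertices_reduction_eq_Un[OF P]
      by (auto simp: reduction_def admissible_vertices_def)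
  next
    case fixed
    with assms show ?thesis by (auto simp: reduction_def)
  qed
  then show "\<tau> w \<in> vertices (reduction P)" "\<tau> w \<in> allowed (reduction P) w" by auto
qed

lemma matching_involution_feasible: "\<tau> \<in> lap_feasible (reduction P)"
proof -
  have "bij_betw \<tau> (vertices (reduction P)) (vertices (reduction P))"
    by (rule bij_betw_byWitness[where f' = \<tau>]) (use \<tau>_\<tau> \<tau>_in in auto)
  moreover have "\<tau> \<in> (\<Pi>\<^sub>E w\<in>vertices (reduction P). allowed (reduction P) w)"
    using \<tau>_in by (auto simp: PiE_iff extensional_def matching_involution_def)
  ultimately show ?thesis
    by (simp add: lap_feasible_def labels_reduction)
qed

lemma total_cost_matching_involution: "total_cost (reduction P) \<tau> = total_cost P x"
proof -
  have "inj_on \<tau> (vertices (reduction P))"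
    by (rule inj_on_inverseI[where g = \<tau>]) (rule \<tau>_\<tau>)
  then have inv: "inv_into (vertices (reduction P)) \<tau> v = \<tau> v" if "v \<in> vertices P" for v
    using that \<tau>_\<tau> \<tau>_in vertices_reduction_eq_Un[OF P] by (intro inv_into_f_eq) auto
  \<comment> \<open>No label is a vertex, so \<open>\<tau>\<close> fixes a vertex only when
    \<open>x\<close> gives it the dummy.\<close>
  have recover: "fixed_to_dummy P \<tau> v = x v" if "v \<in> vertices P" for v
    using that x_label[of v] by (auto simp: fixed_to_dummy_def \<tau>_vertex)
  have "fixed_to_dummy P (inv_into (vertices (reduction P)) \<tau>) v = x v"
    if "v \<in> vertices P" for v
    using that inv[OF that] recover[OF that] by (auto simp: fixed_to_dummy_def split: if_splits)
  with recover show ?thesis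
    unfolding total_cost_reduction[OF P matching_involution_feasible]
    by (simp add: total_cost_def)
qed

end

theorem proposition3:
  fixes P :: "('a, 'a) incomplete_assignment_problem"
  assumes "ilap_instance P"
  shows "ilap_value P = lap_value (reduction P)"
proof (rule antisym)
  show "ilap_value P \<le> lap_value (reduction P)"
    unfolding ilap_value_def lap_value_def optimal_value_def
  proof (rule INF_mono)
    fix \<pi> assume \<pi>: "\<pi> \<in> lap_feasible (reduction P)"
    let ?x = "fixed_to_dummy P \<pi>"
    let ?y = "fixed_to_dummy P (inv_into (vertices (reduction P)) \<pi>)"
    \<comment> \<open>A mean of two reals is at least one of them; which one depends on
      \<open>\<pi>\<close>, so the witness is chosen by cases.\<close>
    have "total_cost P ?x \<le> total_cost (reduction P) \<pi> \<or>
        total_cost P ?y \<le> total_cost (reduction P) \<pi>"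
      unfolding total_cost_reduction[OF assms \<pi>] by (auto simp: field_simps)
    then show "\<exists>x\<in>ilap_feasible P.
        ereal (total_cost P x) \<le> ereal (total_cost (reduction P) \<pi>)"
      using fixed_to_dummy_lap_feasible[OF assms \<pi>] fixed_to_dummy_inv_lap_feasible[OF assms \<pi>]
      by auto
  qed
  show "lap_value (reduction P) \<le> ilap_value P"
    unfolding ilap_value_def lap_value_def optimal_value_def
  proof (rule INF_mono)
    fix x assume x: "x \<in> ilap_feasible P"
    then show "\<exists>\<pi>\<in>lap_feasible (reduction P).
        ereal (total_cost (reduction P) \<pi>) \<le> ereal (total_cost P x)"
      using matching_involution_feasible[OF assms x] total_cost_matching_involution[OF assms x]
      by (intro bexI[where x = "matching_involution P x"]) simp_all
  qed
qed

end
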